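(* For every large enough absolute constant $K$ (i.e. there is an absolute constant $K_0$ such that the following holds for every $K\ge K_0$): fix any $0<\alpha<\frac1{2000\sqrt2}K^{-1}$. For every initialization $(x_0,y_0)$ with $$x_0\in\left(\alpha^{-1}+\tfrac1{15}K^{-2}\alpha^{-1},\ \alpha^{-1}+\tfrac16K^{-2}\alpha^{-1}\right)\quad\text{and}\quad|x_0y_0-1|\in(0,K^{-1}),$$ and every step size $\eta\in(\alpha^2-\frac1{10}K^{-2}\alpha^2,\ \alpha^2)$, the gradient descent trajectory $$x_{t+1}=x_t-\eta x_ty_t^2(x_t^2y_t^2-1),\qquad y_{t+1}=y_t-\eta x_t^2y_t(x_t^2y_t^2-1)$$ from $(x_0,y_0)$ converges to a (global) minimum whose sharpness $\lambda$ satisfies $\lambda\in\left(\frac2\eta-\frac{20}3\eta,\ \frac2\eta\right)$.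
   Context: The trajectory is gradient descent on $\mathcal L(x,y,z,w)=\frac12(1-xyzw)^2$ with coupled initialization $z_0=x_0$, $w_0=y_0$ (the coupling $z_t=x_t$, $w_t=y_t$ is preserved). A global minimum is a point $(x,y)$ with $x^2y^2=1$. The sharpness at $(x,y)$ is the largest eigenvalue of the $4\times4$ Hessian of $\mathcal L$ at the point with $z=x$, $w=y$. *)

theory Defs
  imports "HOL-Analysis.Analysis"
begin

text \<open>Meaningful only where \<open>f\<close> is differentiable at \<open>p\<close>; \<open>gderiv_loss\<close> below shows that
  this is the case everywhere for the loss considered here.\<close>

definition gradient :: "('a::real_inner \<Rightarrow> real) \<Rightarrow> 'a \<Rightarrow> 'a" where
  "gradient f p = (THE D. GDERIV f p :> D)"

definition hessian :: "(real^'n \<Rightarrow> real) \<Rightarrow> real^'n \<Rightarrow> real^'n^'n" where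
  "hessian f p = matrix (frechet_derivative (gradient f) (at p))"

definition eigenvalues :: "real^'n^'n \<Rightarrow> real set" where
  "eigenvalues A = {l. \<exists>v. v \<noteq> 0 \<and> A *v v = l *\<^sub>R v}"

definition loss :: "real^4 \<Rightarrow> real" where
  "loss p = (1 - p$1 * p$2 * p$3 * p$4)\<^sup>2 / 2"

text \<open>The coordinates of a point are \<open>(x, y, z, w)\<close>; the coupled points are those with
  \<open>z = x\<close> and \<open>w = y\<close>.\<close>

definition coupled :: "real \<Rightarrow> real \<Rightarrow> real^4" where
  "coupled x y = vector [x, y, x, y]"

definition sharpness :: "real \<Rightarrow> real \<Rightarrow> real" where
  "sharpness x y = Max (eigenvalues (hessian loss (coupled x y)))"

definition global_minimum :: "real \<Rightarrow> real \<Rightarrow> bool" where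
  "global_minimum x y \<longleftrightarrow> x\<^sup>2 * y\<^sup>2 = 1"

definition gd_trajectory :: "real \<Rightarrow> (nat \<Rightarrow> real) \<Rightarrow> (nat \<Rightarrow> real) \<Rightarrow> bool" where
  "gd_trajectory \<eta> x y \<longleftrightarrow> (\<forall>t.
     x (Suc t) = x t - \<eta> * x t * (y t)\<^sup>2 * ((x t)\<^sup>2 * (y t)\<^sup>2 - 1) \<and>
     y (Suc t) = y t - \<eta> * (x t)\<^sup>2 * y t * ((x t)\<^sup>2 * (y t)\<^sup>2 - 1))"

lemma gradient_eqI: "GDERIV f p :> D \<Longrightarrow> gradient f p = D"
  unfolding gradient_def
proof (rule the_equality)
  fix E assume "GDERIV f p :> D" "GDERIV f p :> E"
  then have "(\<lambda>h. h \<bullet> E) = (\<lambda>h. h \<bullet> D)"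
    unfolding gderiv_def by (blast intro: has_derivative_unique)
  then have "(E - D) \<bullet> (E - D) = 0"
    by (metis diff_self inner_diff_right)
  then show "E = D" by simp
qed

lemma vector_4_nth [simp]:
  "(vector [a, b, c, d] :: 'a::zero^4) $ 1 = a"
  "(vector [a, b, c, d] :: 'a::zero^4) $ 2 = b"
  "(vector [a, b, c, d] :: 'a::zero^4) $ 3 = c"
  "(vector [a, b, c, d] :: 'a::zero^4) $ 4 = d"
  by (simp_all add: vector_def)

lemma gderiv_loss:
  "GDERIV loss p :> (p$1 * p$2 * p$3 * p$4 - 1) *\<^sub>R
     vector [p$2 * p$3 * p$4, p$1 * p$3 * p$4, p$1 * p$2 * p$4, p$1 * p$2 * p$3]"
  unfolding gderiv_def loss_def
  by (rule has_derivative_eq_rhs, (rule derivative_intros bounded_linear.has_derivative[OF bounded_linear_vec_nth] | simp)+)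
    (simp add: fun_eq_iff inner_vec_def sum_4 field_simps)

lemma gradient_loss:
  "gradient loss p = (p$1 * p$2 * p$3 * p$4 - 1) *\<^sub>R
     vector [p$2 * p$3 * p$4, p$1 * p$3 * p$4, p$1 * p$2 * p$4, p$1 * p$2 * p$3]"
  by (rule gradient_eqI[OF gderiv_loss])

lemma global_minimum_iff: "global_minimum x y \<longleftrightarrow> (\<forall>q. loss (coupled x y) \<le> loss q)"
proof
  assume "global_minimum x y"
  then have "loss (coupled x y) = 0"
    by (simp add: global_minimum_def loss_def coupled_def power2_eq_square algebra_simps)
  then show "\<forall>q. loss (coupled x y) \<le> loss q" by (simp add: loss_def)
next
  assume "\<forall>q. loss (coupled x y) \<le> loss q"
  then have "loss (coupled x y) \<le> loss (coupled 1 1)" by blast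
  then have "1 - x * y * x * y = 0" by (simp add: loss_def coupled_def)
  then show "global_minimum x y"
    by (simp add: global_minimum_def power2_eq_square algebra_simps)
qed

text \<open>The two-dimensional recursion is gradient descent on the loss, started at a coupled point.\<close>

lemma gd_trajectory_iff:
  "gd_trajectory \<eta> x y \<longleftrightarrow>
     (\<forall>t. coupled (x (Suc t)) (y (Suc t)) =
            coupled (x t) (y t) - \<eta> *\<^sub>R gradient loss (coupled (x t) (y t)))"
  unfolding gd_trajectory_def
  by (auto simp: coupled_def gradient_loss vec_eq_iff forall_4 power2_eq_square algebra_simps)

end

theory Submission
  imports Defs
begin

text \<open>Put \<open>e = \<eta>\<^sup>2\<close>, \<open>f = x\<^sup>2y\<^sup>2 - 1\<close>, \<open>r = \<eta>(x\<^sup>2 - y\<^sup>2)\<close> and \<open>s = \<eta>(x\<^sup>2 + y\<^sup>2)\<close>. The conserved quantity of the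
  gradient flow only decreases along gradient descent, exactly by \<open>r \<mapsto> r(1 - e(1 + f)f\<^sup>2)\<close>, and
  \<open>s\<^sup>2 = r\<^sup>2 + 4e(1 + f)\<close>. With \<open>d = sqrt(r\<^sup>2 + 4e) - 1\<close>, a limit with \<open>f = 0\<close> has sharpness
  \<open>2(1 + d)/\<eta>\<close>, so the claim is that \<open>f\<close> tends to \<open>0\<close> and \<open>d\<close> to a limit in \<open>(-10e/3, 0)\<close>.

  Since \<open>f\<close> is approximately sent to \<open>-f\<close>, use the square \<open>V\<close> of the normal form coordinate
  \<open>h = f + (1/2 + e)f\<^sup>2\<close>. Up to small relative errors
  \<open>V \<mapsto> V(1 + 4d - 4V)\<close> and \<open>d \<mapsto> d - eV\<close>.
  As long as \<open>d \<ge> 0\<close>, \<open>V\<close> cannot become small and \<open>d\<close> keeps decreasing; once \<open>d < 0\<close>, \<open>V\<close> decays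
  geometrically. The barrier \<open>V \<le> 2(d + e) + D(d + e)\<^sup>2\<close> is preserved and gives \<open>d \<ge> -e\<close>.\<close>

section \<open>Sharpness at a minimum\<close>

text \<open>The gradient is \<open>xyzw - 1\<close> times the gradient \<open>G\<close> of the
  product. Where the product is 1, only the derivative of the first factor survives, so the Hessian
  is the rank-one matrix of \<open>v = G q\<close>, whose only eigenvalues are 0 and
  \<open>v \<bullet> v\<close>.\<close>

lemma sharpness_at_minimum:
  assumes "a\<^sup>2 * b\<^sup>2 = (1::real)"
  shows "sharpness a b = 2 * (a\<^sup>2 + b\<^sup>2)"
proof -
  define q where "q = coupled a b"
  define G where "G = (\<lambda>p::real^4. vector [p$2 * p$3 * p$4, p$1 * p$3 * p$4, p$1 * p$2 * p$4, p$1 * p$2 * p$3] :: real^4)"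
  define v where "v = G q"
  have q: "q$1 = a" "q$2 = b" "q$3 = a" "q$4 = b" by (auto simp: q_def coupled_def)
  have one: "a * b * a * b = 1" using assms by (simp add: power2_eq_square algebra_simps)
  \<comment> \<open>Existence of a derivative of \<open>G\<close> suffices: in the product rule its
    value is multiplied by \<open>xyzw - 1\<close>, which is 0 at \<open>q\<close>.\<close>
  have dG: "G differentiable (at q)"
  proof -
    have "(\<lambda>p. G p $ i) differentiable (at q)" for i
    proof -
      have "\<forall>i. (\<lambda>p. G p $ i) differentiable (at q)"
        unfolding forall_4 G_def vector_4_nth
        by (intro conjI derivative_intros bounded_linear_imp_differentiable bounded_linear_vec_nth)
      then show ?thesis by blast
    qed
    then show ?thesis
      by (subst differentiable_componentwise_within) (auto simp: Basis_vec_def inner_axis)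
  qed
  then obtain G' where G': "(G has_derivative G') (at q)" by (auto simp: differentiable_def)
  have dP: "((\<lambda>p::real^4. p$1 * p$2 * p$3 * p$4 - 1) has_derivative (\<lambda>h. h \<bullet> v)) (at q)"
    by (rule has_derivative_eq_rhs, (rule derivative_intros bounded_linear.has_derivative[OF bounded_linear_vec_nth] | simp)+)
      (simp add: fun_eq_iff inner_vec_def sum_4 v_def G_def q field_simps)
  have "(gradient loss has_derivative (\<lambda>h. (h \<bullet> v) *\<^sub>R v)) (at q)"
  proof -
    have "gradient loss = (\<lambda>p. (p$1 * p$2 * p$3 * p$4 - 1) *\<^sub>R G p)"
      by (rule ext) (simp add: gradient_loss G_def)
    then show ?thesis
      using has_derivative_scaleR[OF dP G'] by (simp add: q one v_def)
  qed
  then have "hessian loss q = matrix (\<lambda>h. (h \<bullet> v) *\<^sub>R v)"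
    unfolding hessian_def by (metis frechet_derivative_at)
  then have H: "hessian loss q *v h = (h \<bullet> v) *\<^sub>R v" for h
    using matrix_works[of "\<lambda>h. (h \<bullet> v) *\<^sub>R v"]
    by (simp add: linear_iff inner_add_left scaleR_add_left)
  have vv: "v \<bullet> v = 2 * (a\<^sup>2 + b\<^sup>2)"
  proof -
    have "v \<bullet> v = 2 * (a\<^sup>2 * b\<^sup>2) * (a\<^sup>2 + b\<^sup>2)"
      by (simp add: inner_vec_def sum_4 v_def G_def q power2_eq_square algebra_simps)
    then show ?thesis using assms by simp
  qed
  have pos: "v \<bullet> v > 0"
    using assms unfolding vv by (cases "a = 0") (auto intro: add_pos_nonneg)
  have sub: "eigenvalues (hessian loss q) \<subseteq> {0, v \<bullet> v}"
  proof
    fix l assume "l \<in> eigenvalues (hessian loss q)"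
    then obtain u where u: "u \<noteq> 0" "(u \<bullet> v) *\<^sub>R v = l *\<^sub>R u" by (auto simp: eigenvalues_def H)
    then have "((u \<bullet> v) *\<^sub>R v) \<bullet> v = (l *\<^sub>R u) \<bullet> v" by simp
    then have "(u \<bullet> v) * (v \<bullet> v - l) = 0" by (simp add: algebra_simps)
    then show "l \<in> {0, v \<bullet> v}" using u by auto
  qed
  have mem: "v \<bullet> v \<in> eigenvalues (hessian loss q)"
    using pos unfolding eigenvalues_def by (auto simp: H intro!: exI[of _ v])
  have "Max (eigenvalues (hessian loss q)) = v \<bullet> v"
    by (rule Max_eqI) (use sub mem pos in \<open>auto intro: finite_subset\<close>)
  then show ?thesis by (simp add: sharpness_def q_def[symmetric] vv)
qed

section \<open>One-step estimates near f = 0, d = 0\<close>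

lemma abs_mult_le: "\<bar>a\<bar> \<le> A \<Longrightarrow> \<bar>b\<bar> \<le> B \<Longrightarrow> \<bar>a * b\<bar> \<le> A * B" for a b A B :: real
  by (auto simp: abs_mult intro!: mult_mono order_trans[OF abs_ge_zero])

text \<open>Near \<open>f = 0\<close>, \<open>d = 0\<close> one step acts as \<open>f \<mapsto> -f - (1 + 2e) f\<^sup>2 + f\<^sup>3 - 2df\<close>. The coefficient
  \<open>1/2 + e\<close> in \<open>h\<close> removes the quadratic term, so that \<open>h\<close> just changes sign up to a factor
  \<open>1 + 2d - 2h\<^sup>2\<close>; it has to be exact in \<open>e\<close>, as an error of order \<open>ef\<close> would dominate \<open>h\<^sup>2\<close>
  near the end of the trajectory.\<close>

lemma step_square:
  fixes f d e s f' h h' :: real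
  assumes f: "\<bar>f\<bar> \<le> 1 / 10000" and d: "\<bar>d\<bar> \<le> 1 / 10000" and e: "0 \<le> e" "e \<le> 1 / 10000"
    and s: "0 \<le> s" "s\<^sup>2 = (1 + d)\<^sup>2 + 4 * e * f"
    and f': "f' = (1 + f) * (1 - s * f + e * (1 + f) * f\<^sup>2)\<^sup>2 - 1"
    and h: "h = f + (1 / 2 + e) * f\<^sup>2" and h': "h' = f' + (1 / 2 + e) * f'\<^sup>2"
  shows "\<bar>f'\<bar> \<le> 2 * \<bar>f\<bar>" "\<bar>h'\<^sup>2 - h\<^sup>2 * (1 + 4 * d - 4 * h\<^sup>2)\<bar> \<le> h\<^sup>2 * (\<bar>d\<bar> + h\<^sup>2) / 10"
proof -
  \<comment> \<open>\<open>g\<close> is the common scale of all errors: each relative error below is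
    bounded by a small multiple of \<open>g\<close>, which is comparable to the
    \<open>\<bar>d\<bar> + h\<^sup>2\<close> of the claim.\<close>
  define g where "g = \<bar>d\<bar> + f\<^sup>2"
  have ff: "f\<^sup>2 \<le> \<bar>f\<bar> / 10000"
    using mult_right_mono[OF f abs_ge_zero[of f]] by (simp add: power2_eq_square flip: abs_mult)
  have g0: "0 \<le> g" "g \<le> 11 / 100000" "\<bar>d\<bar> \<le> g" "f\<^sup>2 \<le> g" "0 \<le> f\<^sup>2"
    using d f ff by (auto simp: g_def)
  have ef2: "0 \<le> e * f\<^sup>2" "e * f\<^sup>2 \<le> g / 10000"
    using mult_mono[OF e(2) g0(4)] e by auto
  have efa: "\<bar>e * f\<bar> \<le> 1 / 10000 * (1 / 10000)"
    by (rule abs_mult_le) (use e f in auto)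
  have "s \<ge> 9 / 10"
  proof (rule power2_le_imp_le[OF _ s(1)])
    have "(1 + d)\<^sup>2 \<ge> (99 / 100)\<^sup>2" by (rule power_mono) (use d in auto)
    then show "(9 / 10)\<^sup>2 \<le> s\<^sup>2" using s(2) efa by (simp add: power2_eq_square abs_le_iff)
  qed
  then have sl: "s + 1 + d \<ge> 9 / 5" using d by auto

  \<comment> \<open>Expansion \<open>s = 1 + d + 2ef + \<rho>\<close>. Dividing the difference of
    squares \<open>s1\<close> by \<open>s + 1 + d\<close> gives the linear term, and
    \<open>\<rho> (s + 1 + d) = 2ef (1 - s - d)\<close> shows that the rest is of second
    order.\<close>
  define \<rho> where "\<rho> = s - 1 - d - 2 * e * f"
  have s1: "(s - 1 - d) * (s + 1 + d) = 4 * (e * f)"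
    using s(2) by (simp add: power2_eq_square algebra_simps)
  have "\<bar>s - 1 - d\<bar> * (9 / 5) \<le> \<bar>s - 1 - d\<bar> * \<bar>s + 1 + d\<bar>"
    by (rule mult_left_mono) (use sl in auto)
  also have "\<dots> = 4 * \<bar>e * f\<bar>" unfolding abs_mult[symmetric] s1 by (simp add: abs_mult)
  finally have "\<bar>s - 1 - d\<bar> \<le> 3 * \<bar>e * f\<bar>" using abs_ge_zero[of "e * f"] by argo
  moreover have "\<bar>1 - s - d\<bar> \<le> 2 * \<bar>d\<bar> + \<bar>s - 1 - d\<bar>" by argo
  ultimately have s2: "\<bar>1 - s - d\<bar> \<le> 2 * \<bar>d\<bar> + 3 * \<bar>e * f\<bar>" by argo
  have "\<bar>\<rho>\<bar> * (9 / 5) \<le> \<bar>\<rho>\<bar> * \<bar>s + 1 + d\<bar>"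
    by (rule mult_left_mono) (use sl in auto)
  also have "\<dots> = \<bar>2 * (e * f) * (1 - s - d)\<bar>"
    unfolding abs_mult[symmetric] \<rho>_def using s1 by (simp add: algebra_simps)
  also have "\<dots> \<le> 2 * \<bar>e * f\<bar> * (2 * \<bar>d\<bar> + 3 * \<bar>e * f\<bar>)"
    by (rule abs_mult_le[OF _ s2]) (simp add: abs_mult)
  also have "\<dots> = 4 * (\<bar>e * f\<bar> * \<bar>d\<bar>) + 6 * (e * (e * f\<^sup>2))"
    using e by (simp add: abs_mult power2_eq_square algebra_simps)
  also have "\<dots> \<le> 4 * (1 / 100000000 * g) + 6 * (1 / 10000 * (g / 10000))"
    by (intro add_mono mult_left_mono mult_mono) (use efa g0 ef2 e in auto)
  finally have \<rho>: "\<bar>\<rho>\<bar> \<le> g / 10000" using g0 by argo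

  \<comment> \<open>The factor squared in \<open>f'\<close> is
    \<open>1 - f + f\<mu>\<close>.\<close>
  define \<mu> where "\<mu> = - d - e * f + (e * f\<^sup>2 - \<rho>)"
  have r2: "\<bar>e * f\<^sup>2 - \<rho>\<bar> \<le> 2 * g / 10000" using \<rho> ef2 by argo
  have \<mu>: "\<bar>\<mu>\<bar> \<le> 1 / 5000" unfolding \<mu>_def using r2 efa d g0(2) by argo
  have fd: "\<bar>f * d\<bar> \<le> 1 / 10000 * g" by (rule abs_mult_le) (use f g0 in auto)
  have f\<mu>: "\<bar>f * \<mu>\<bar> \<le> 3 * g / 10000"
  proof -
    have "\<bar>f * (e * f\<^sup>2 - \<rho>)\<bar> \<le> 1 / 10000 * (2 * g / 10000)" by (rule abs_mult_le[OF f r2])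
    moreover have "f * \<mu> = f * (e * f\<^sup>2 - \<rho>) - f * d - e * f\<^sup>2"
      by (simp add: \<mu>_def power2_eq_square algebra_simps)
    ultimately show ?thesis using fd ef2 g0 by argo
  qed

  define \<kappa> where "\<kappa> = 2 * (e * f\<^sup>2 - \<rho>) - 2 * (f\<^sup>2 * \<mu>) + (1 + f) * (f * \<mu> * \<mu>)"
  have \<kappa>: "\<bar>\<kappa>\<bar> \<le> 10 * g / 10000"
  proof -
    have "\<bar>f\<^sup>2 * \<mu>\<bar> \<le> g * (1 / 5000)" by (rule abs_mult_le[OF _ \<mu>]) (use g0 in auto)
    moreover have "\<bar>(1 + f) * (f * \<mu> * \<mu>)\<bar> \<le> 2 * ((3 * g / 10000) * (1 / 5000))"
      by (intro abs_mult_le f\<mu> \<mu>) (use f in auto)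
    ultimately show ?thesis unfolding \<kappa>_def using r2 g0(1) by argo
  qed

  \<comment> \<open>Expanding the square isolates the main terms -f - (1 + 2e) f^2 + f^3 - 2df;
    \<open>\<kappa>\<close> is everything else, divided by \<open>f\<close>.\<close>
  define \<nu> where "\<nu> = (1 + 2 * e) * f - f\<^sup>2 + 2 * d - \<kappa>"
  have f'\<nu>: "f' = - f - f * \<nu>"
    unfolding f' \<nu>_def \<kappa>_def \<mu>_def \<rho>_def by algebra
  have "\<bar>(1 + 2 * e) * f\<bar> \<le> 2 * (1 / 10000)" by (rule abs_mult_le) (use e f in auto)
  then have \<nu>: "\<bar>\<nu>\<bar> \<le> 1 / 1000" unfolding \<nu>_def using g0 \<kappa> d by argo
  have "\<bar>f * \<nu>\<bar> \<le> \<bar>f\<bar> * (1 / 1000)" by (rule abs_mult_le[OF _ \<nu>]) simp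
  then show "\<bar>f'\<bar> \<le> 2 * \<bar>f\<bar>" unfolding f'\<nu> by argo
  have f3: "\<bar>f * f\<^sup>2\<bar> \<le> 1 / 10000 * g" by (rule abs_mult_le) (use f g0 in auto)
  have f\<kappa>: "\<bar>f * \<kappa>\<bar> \<le> 1 / 10000 * (10 * g / 10000)" by (rule abs_mult_le[OF f \<kappa>])
  \<comment> \<open>\<open>\<nu>\<close> alone contains a term of order \<open>f\<close>, too large
    compared with \<open>g\<close>; multiplied by \<open>f\<close>, that term becomes of order
    f^2.\<close>
  have f\<nu>: "\<bar>f * \<nu>\<bar> \<le> 2 * g"
  proof -
    have "f * \<nu> = f\<^sup>2 + 2 * (e * f\<^sup>2) - f * f\<^sup>2 + 2 * (f * d) - f * \<kappa>"
      by (simp add: \<nu>_def power2_eq_square algebra_simps)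
    then show ?thesis using ef2 f3 fd f\<kappa> g0 by argo
  qed

  \<comment> \<open>The f^2 coefficient of \<open>h'\<close> is \<open>a - (1 + 2e)\<close>, which
    equals \<open>-a\<close> because 2a = 1 + 2e. Hence the quadratic terms of \<open>h'\<close> and
    \<open>-h\<close> agree, and \<open>\<Omega>\<close> collects what remains, relative to
    \<open>f\<close>.\<close>
  define a where "a = 1 / 2 + e"
  define \<Omega> where "\<Omega> = (4 + 4 * e) * (e * f\<^sup>2) + \<kappa> + (1 + 2 * e) * (2 * (f * d) - f * f\<^sup>2 - f * \<kappa>)
     + a * (f * \<nu> * \<nu>) + 2 * (a * (f * d)) - 2 * (a * (f * f\<^sup>2))"
  have \<Omega>: "\<bar>\<Omega>\<bar> \<le> g / 100"
  proof -
    have "\<bar>(4 + 4 * e) * (e * f\<^sup>2)\<bar> \<le> 5 * (g / 10000)"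
      by (rule abs_mult_le) (use e ef2 in auto)
    moreover have "\<bar>2 * (f * d) - f * f\<^sup>2 - f * \<kappa>\<bar> \<le> 4 * g / 10000"
      using fd f3 f\<kappa> g0(1) unfolding abs_le_iff by linarith
    then have "\<bar>(1 + 2 * e) * (2 * (f * d) - f * f\<^sup>2 - f * \<kappa>)\<bar> \<le> 2 * (4 * g / 10000)"
      by (rule abs_mult_le[rotated]) (use e in auto)
    moreover have "\<bar>a * (f * \<nu> * \<nu>)\<bar> \<le> 1 * (2 * g * (1 / 1000))"
      by (intro abs_mult_le f\<nu> \<nu>) (use e in \<open>auto simp: a_def\<close>)
    moreover have "\<bar>a * (f * d)\<bar> \<le> 1 * (1 / 10000 * g)"
      by (intro abs_mult_le fd) (use e in \<open>auto simp: a_def\<close>)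
    moreover have "\<bar>a * (f * f\<^sup>2)\<bar> \<le> 1 * (1 / 10000 * g)"
      by (intro abs_mult_le f3) (use e in \<open>auto simp: a_def\<close>)
    ultimately show ?thesis using \<kappa> g0(1) unfolding \<Omega>_def abs_le_iff by linarith
  qed
  have err: "h' = - (1 + 2 * d - 2 * f\<^sup>2) * h + f * \<Omega>"
    unfolding h h' f'\<nu> \<Omega>_def a_def unfolding \<nu>_def by algebra

  \<comment> \<open>Writing \<open>h = f c\<close> with \<open>c\<close> close to 1 turns the error
    \<open>f \<Omega>\<close> into one relative to \<open>h\<close>, so that
    \<open>h' = -h (1 + z)\<close> can be squared.\<close>
  define c where "c = 1 + a * f"
  have af: "\<bar>a * f\<bar> \<le> 1 * (1 / 10000)" by (intro abs_mult_le f) (use e in \<open>auto simp: a_def\<close>)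
  then have c: "c \<ge> 99 / 100" "\<bar>c - 1\<bar> \<le> 1 / 10000" "\<bar>c + 1\<bar> \<le> 3" by (auto simp: c_def)
  have hc: "h = f * c" by (simp add: h c_def a_def power2_eq_square algebra_simps)
  define \<omega> where "\<omega> = \<Omega> / c"
  define z where "z = 2 * d - 2 * f\<^sup>2 - \<omega>"
  have "h' = - h * (1 + z)" using c(1) by (simp add: err hc z_def \<omega>_def field_simps)
  then have "h'\<^sup>2 - h\<^sup>2 * (1 + 4 * d - 4 * h\<^sup>2) = h\<^sup>2 * (2 * z + z\<^sup>2 - 4 * d + 4 * h\<^sup>2)"
    by algebra
  also have "2 * z + z\<^sup>2 - 4 * d + 4 * h\<^sup>2 = z * z - 2 * \<omega> + 4 * (h\<^sup>2 - f\<^sup>2)"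
    by (simp add: z_def power2_eq_square)
  finally have eq: "\<bar>h'\<^sup>2 - h\<^sup>2 * (1 + 4 * d - 4 * h\<^sup>2)\<bar> = h\<^sup>2 * \<bar>z * z - 2 * \<omega> + 4 * (h\<^sup>2 - f\<^sup>2)\<bar>"
    by (simp add: abs_mult)
  have hf: "\<bar>h\<^sup>2 - f\<^sup>2\<bar> \<le> f\<^sup>2 * (1 / 10000 * 3)"
  proof -
    have "h\<^sup>2 - f\<^sup>2 = f\<^sup>2 * ((c - 1) * (c + 1))" by (simp add: hc power2_eq_square algebra_simps)
    then show ?thesis by (simp only:) (intro abs_mult_le c, simp)
  qed
  have \<omega>: "\<bar>\<omega>\<bar> \<le> g / 90"
  proof -
    have "\<bar>\<Omega>\<bar> \<le> g / 90 * c" using \<Omega> mult_left_mono[OF c(1), of "g / 90"] g0(1) by argo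
    then show ?thesis using c(1) by (simp add: \<omega>_def abs_divide pos_divide_le_eq)
  qed
  have z: "\<bar>z\<bar> \<le> 3 * g" unfolding z_def using \<omega> g0(1,5) unfolding g_def by argo
  have "\<bar>z * z\<bar> \<le> (1 / 1000) * (3 * g)" by (rule abs_mult_le[OF _ z]) (use z g0 in linarith)
  then have "\<bar>z * z - 2 * \<omega> + 4 * (h\<^sup>2 - f\<^sup>2)\<bar> \<le> (\<bar>d\<bar> + h\<^sup>2) / 10"
    using \<omega> hf g0(5) unfolding g_def by argo
  from mult_left_mono[OF this, of "h\<^sup>2"] show "\<bar>h'\<^sup>2 - h\<^sup>2 * (1 + 4 * d - 4 * h\<^sup>2)\<bar> \<le> h\<^sup>2 * (\<bar>d\<bar> + h\<^sup>2) / 10"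
    unfolding eq by simp
qed

text \<open>Here \<open>h = f (1 + (1/2 + e) f)\<close>, and the second factor is within one percent
  of 1; this transfers bounds between \<open>f\<close> and \<open>V\<close>.\<close>

lemma corrected_square_bounds:
  fixes f e :: real
  assumes f: "\<bar>f\<bar> \<le> 1 / 10000" and e: "0 \<le> e" "e \<le> 1 / 10000"
  defines "h \<equiv> f + (1 / 2 + e) * f\<^sup>2"
  shows "99 / 100 * \<bar>f\<bar> \<le> \<bar>h\<bar>" "\<bar>h\<bar> \<le> 101 / 100 * \<bar>f\<bar>"
    and "98 / 100 * f\<^sup>2 \<le> h\<^sup>2" "h\<^sup>2 \<le> 103 / 100 * f\<^sup>2"
proof -
  have "\<bar>(1 / 2 + e) * f\<bar> \<le> 1 * (1 / 10000)" by (rule abs_mult_le[OF _ f]) (use e in auto)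
  then have c: "99 / 100 \<le> \<bar>1 + (1 / 2 + e) * f\<bar>" "\<bar>1 + (1 / 2 + e) * f\<bar> \<le> 101 / 100" by auto
  have h: "\<bar>h\<bar> = \<bar>1 + (1 / 2 + e) * f\<bar> * \<bar>f\<bar>"
    by (simp add: h_def power2_eq_square algebra_simps flip: abs_mult)
  show l: "99 / 100 * \<bar>f\<bar> \<le> \<bar>h\<bar>" unfolding h by (rule mult_right_mono) (use c in auto)
  show u: "\<bar>h\<bar> \<le> 101 / 100 * \<bar>f\<bar>" unfolding h by (rule mult_right_mono) (use c in auto)
  have "(99 / 100 * \<bar>f\<bar>)\<^sup>2 \<le> \<bar>h\<bar>\<^sup>2" by (rule power_mono[OF l]) simp
  moreover have "\<bar>h\<bar>\<^sup>2 \<le> (101 / 100 * \<bar>f\<bar>)\<^sup>2" by (rule power_mono[OF u]) simp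
  ultimately show "98 / 100 * f\<^sup>2 \<le> h\<^sup>2" "h\<^sup>2 \<le> 103 / 100 * f\<^sup>2"
    using zero_le_power2[of f] unfolding power_mult_distrib power2_abs by (simp_all add: power2_eq_square)
qed

text \<open>With \<open>S = 1 + d\<close> and \<open>z = e (1 + f) f\<^sup>2\<close>, the constant
  4e cancels in S^2 - S'^2 = r^2 z (2 - z). Since S + S' is about 2 and r^2 about 1, dividing gives
  a decrease of \<open>d\<close> close to \<open>z\<close>, hence close to
  \<open>e h\<^sup>2\<close>.\<close>

lemma drift_step:
  fixes f d e r r' d' :: real
  assumes f: "\<bar>f\<bar> \<le> 1 / 10000" and d: "\<bar>d\<bar> \<le> 1 / 10000" and e: "0 \<le> e" "e \<le> 1 / 10000"
    and r: "r\<^sup>2 + 4 * e = (1 + d)\<^sup>2" and r': "r' = r * (1 - e * (1 + f) * f\<^sup>2)"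
    and d': "d' = sqrt (r'\<^sup>2 + 4 * e) - 1"
    and h: "h = f + (1 / 2 + e) * f\<^sup>2"
  shows "9 / 10 * (e * h\<^sup>2) \<le> d - d'" "d - 11 / 10 * (e * h\<^sup>2) \<le> d'"
proof -
  define F where "F = e * f\<^sup>2"
  define z where "z = (1 + f) * F"
  have F0: "0 \<le> F" using e by (simp add: F_def)
  have "\<bar>f * f\<bar> \<le> 1 / 10000 * (1 / 10000)" by (rule abs_mult_le[OF f f])
  then have F1: "F \<le> 1 / 10000 * (1 / 10000 * (1 / 10000))"
    unfolding F_def by (intro mult_mono e) (auto simp: power2_eq_square)
  have zF: "99 / 100 * F \<le> z" "z \<le> 101 / 100 * F"
    unfolding z_def by (rule mult_right_mono[OF _ F0], use f in linarith)+
  have z: "0 \<le> z" "z \<le> 1 / 10000" using zF F0 F1 by auto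
  have r'z: "r' = r * (1 - z)" by (simp add: r' z_def F_def mult_ac)
  define S where "S = 1 + d"
  define S' where "S' = 1 + d'"
  have S2: "r\<^sup>2 = S\<^sup>2 - 4 * e" using r by (simp add: S_def)
  have S'2: "S'\<^sup>2 = r'\<^sup>2 + 4 * e" "0 \<le> S'" using e by (auto simp: S'_def d')
  have S: "9999 / 10000 \<le> S" "S \<le> 10001 / 10000" using d by (auto simp: S_def)
  have "(9999 / 10000)\<^sup>2 \<le> S\<^sup>2" "S\<^sup>2 \<le> (10001 / 10000)\<^sup>2" using S by (auto intro!: power_mono)
  then have r2: "99 / 100 \<le> r\<^sup>2" "r\<^sup>2 \<le> 101 / 100" using S2 e by (simp_all add: power2_eq_square)
  have diff: "S\<^sup>2 - S'\<^sup>2 = r\<^sup>2 * (z * (2 - z))"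
    unfolding S'2 r'z using S2 by algebra
  have zz: "0 \<le> z * (2 - z)" "199 / 100 * z \<le> z * (2 - z)" "z * (2 - z) \<le> 2 * z"
    using z mult_left_mono[of z "1 / 100" z] by (auto simp: algebra_simps)
  have "S'\<^sup>2 \<le> S\<^sup>2" using diff mult_nonneg_nonneg[OF zero_le_power2[of r] zz(1)] by argo
  then have S'S: "S' \<le> S" using power2_le_imp_le[of S' S] S by simp
  \<comment> \<open>Only r^2 shrinks by (1 - z)^2 while 4e stays fixed, so \<open>S\<close> shrinks
    by no more than the factor 1 - z. This bounds S + S' from below.\<close>
  have S'l: "(1 - z) * S \<le> S'"
  proof (rule power2_le_imp_le[OF _ S'2(2)])
    have "(1 - z)\<^sup>2 \<le> 1" using z by (intro power_le_one) auto
    then have "(1 - z)\<^sup>2 * (4 * e) \<le> 1 * (4 * e)" using e by (intro mult_right_mono) auto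
    moreover have "((1 - z) * S)\<^sup>2 = r'\<^sup>2 + (1 - z)\<^sup>2 * (4 * e)"
      unfolding r'z using S2 by algebra
    ultimately show "((1 - z) * S)\<^sup>2 \<le> S'\<^sup>2" using S'2 by linarith
  qed
  have "z * S \<le> 1 / 10000 * (10001 / 10000)" by (rule mult_mono) (use z S in auto)
  then have sum: "199 / 100 \<le> S + S'" "S + S' \<le> 201 / 100"
    using S'l S S'S by (auto simp: algebra_simps)
  have prod: "(S - S') * (S + S') = r\<^sup>2 * (z * (2 - z))" using diff by algebra
  have "99 / 100 * (199 / 100 * z) \<le> r\<^sup>2 * (z * (2 - z))"
    by (rule mult_mono[OF r2(1) zz(2)]) (use z in auto)
  also have "\<dots> \<le> (S - S') * (201 / 100)"
    unfolding prod[symmetric] by (rule mult_left_mono[OF sum(2)]) (use S'S in simp)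
  finally have low: "98 / 100 * z \<le> d - d'" unfolding S_def S'_def using z by argo
  have "(S - S') * (199 / 100) \<le> r\<^sup>2 * (z * (2 - z))"
    unfolding prod[symmetric] by (rule mult_left_mono[OF sum(1)]) (use S'S in simp)
  also have "\<dots> \<le> 101 / 100 * (2 * z)"
    by (rule mult_mono[OF r2(2) zz(3)]) (use zz in auto)
  finally have up: "d - d' \<le> 102 / 100 * z" unfolding S_def S'_def using z by argo
  have hF: "98 / 100 * F \<le> e * h\<^sup>2" "e * h\<^sup>2 \<le> 103 / 100 * F"
    using mult_left_mono[OF corrected_square_bounds(3)[OF f e] e(1)]
      mult_left_mono[OF corrected_square_bounds(4)[OF f e] e(1)]
    by (auto simp: F_def h)
  show "9 / 10 * (e * h\<^sup>2) \<le> d - d'" "d - 11 / 10 * (e * h\<^sup>2) \<le> d'"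
    using hF low up zF F0 by argo+
qed

section \<open>Barrier and convergence for the recursion of V and d\<close>

text \<open>In the continuous limit \<open>dV/dd = 4(V - d)/e\<close>, so every linear barrier \<open>V \<le> A(d + Be)\<close>
  with \<open>1 < A < 4B\<close> is preserved as \<open>d\<close> decreases. The quadratic term makes room for the initial
  value of \<open>V\<close>.\<close>

lemma barrier_step:
  fixes V d e D V' d' :: real
  assumes e: "0 < e" "e \<le> 1 / 10000" and D: "0 \<le> D" "e * D \<le> 1 / 10" and V: "0 \<le> V"
    and G: "2 * (d + e) + D * (d + e)\<^sup>2 \<le> 1 / 100" and w: "0 \<le> d + e" and d: "\<bar>d\<bar> \<le> 1 / 100"
    and barrier: "V \<le> 2 * (d + e) + D * (d + e)\<^sup>2"
    and V': "V' \<le> V * (1 + 4 * d - 4 * V) + V * (\<bar>d\<bar> + V) / 10"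
    and d': "d - 11 / 10 * (e * V) \<le> d'"
  shows "0 \<le> d' + e" "V' \<le> 2 * (d' + e) + D * (d' + e)\<^sup>2"
proof -
  define w where "w = d + e"
  define G where "G = 2 * w + D * w\<^sup>2"
  \<comment> \<open>The drift is largest when \<open>V = G\<close>, so \<open>w1\<close> is a lower
    bound for \<open>d' + e\<close>.\<close>
  define w1 where "w1 = w - 11 / 10 * (e * G)"
  have w0: "0 \<le> w" and VG: "V \<le> G" and G1: "G \<le> 1 / 100" and G0: "0 \<le> G"
    using w barrier G V by (auto simp: w_def G_def)
  have eDw: "e * D * w \<le> 1 / 10 * w" by (rule mult_right_mono[OF D(2) w0])
  have w1: "0 \<le> w1"
  proof -
    have "w1 = w * (1 - 11 / 10 * (2 * e + e * D * w))"
      by (simp add: w1_def G_def power2_eq_square algebra_simps)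
    moreover have "w \<le> 1" using d e by (simp add: w_def)
    ultimately show ?thesis using w0 e eDw by simp
  qed
  have w': "w1 \<le> d' + e"
  proof -
    have "e * V \<le> e * G" by (rule mult_left_mono[OF VG]) (use e in simp)
    then show ?thesis using d' unfolding w1_def w_def by linarith
  qed
  then show "0 \<le> d' + e" using w1 by linarith
  \<comment> \<open>\<open>\<phi>\<close> is the upper bound for \<open>V'\<close> as a function of
    \<open>V\<close>, with 39/10 = 4 - 1/10. It is increasing on the range considered, so
    \<open>V\<close> may be replaced by the barrier value \<open>G\<close>.\<close>
  define \<phi> where "\<phi> v = v * (1 + 4 * d + \<bar>d\<bar> / 10) - 39 / 10 * v * v" for v
  have "\<phi> G - \<phi> V = (G - V) * (1 + 4 * d + \<bar>d\<bar> / 10 - 39 / 10 * (G + V))"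
    unfolding \<phi>_def by algebra
  moreover have "0 \<le> (G - V) * (1 + 4 * d + \<bar>d\<bar> / 10 - 39 / 10 * (G + V))"
    by (rule mult_nonneg_nonneg) (use VG G1 d in auto)
  ultimately have \<phi>: "\<phi> V \<le> \<phi> G" by linarith
  have "\<phi> V = V * (1 + 4 * d - 4 * V) + V * (\<bar>d\<bar> + V) / 10"
    by (simp add: \<phi>_def field_simps)
  then have "V' \<le> \<phi> V" using V' by simp
  also note \<phi>
  also have "\<phi> G = G * (1 + 4 * d + \<bar>d\<bar> / 10 - 39 / 10 * G)"
    by (simp add: \<phi>_def algebra_simps)
  \<comment> \<open>By 4d = 4w - 4e and \<open>G \<ge> 2w\<close>, the left factor is at most 1 -
    3.7w - 3.9e, while \<open>e D \<le> 1/10\<close> makes the right factor at least 1 - 0.22w -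
    2.2e.\<close>
  also have "\<dots> \<le> G * (1 - 11 / 10 * e * (2 + 2 * D * w))"
  proof (rule mult_left_mono[OF _ G0])
    have "G \<ge> 2 * w" using D by (simp add: G_def)
    moreover have "\<bar>d\<bar> \<le> w + e" using w0 e by (auto simp: w_def abs_le_iff)
    ultimately show "1 + 4 * d + \<bar>d\<bar> / 10 - 39 / 10 * G \<le> 1 - 11 / 10 * e * (2 + 2 * D * w)"
      using eDw w0 e unfolding w_def by (simp add: algebra_simps)
  qed
  \<comment> \<open>The left side is the tangent of the barrier at \<open>w\<close>, of slope 2 +
    2Dw, evaluated at \<open>w1\<close>; by convexity the barrier lies above it.\<close>
  also have "\<dots> \<le> 2 * w1 + D * w1\<^sup>2"
  proof -
    have "2 * w1 + D * w1\<^sup>2 - G * (1 - 11 / 10 * e * (2 + 2 * D * w)) = D * (11 / 10 * (e * G))\<^sup>2"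
      unfolding w1_def G_def by algebra
    then show ?thesis using D by (smt (verit) mult_nonneg_nonneg zero_le_power2)
  qed
  also have "\<dots> \<le> 2 * (d' + e) + D * (d' + e)\<^sup>2"
    by (intro add_mono mult_left_mono power_mono w' w1) (use D in auto)
  finally show "V' \<le> 2 * (d' + e) + D * (d' + e)\<^sup>2" .
qed

text \<open>\<open>V 0 \<noteq> 0\<close> is essential: with \<open>V\<close> identically 0,
  \<open>d\<close> could stay at a positive constant. The limit of \<open>d\<close> is strictly
  negative because \<open>d\<close> is decreasing and becomes negative at some finite time.\<close>

lemma slow_drift_convergence:
  fixes V d :: "nat \<Rightarrow> real"
  assumes e: "0 < e" and V: "\<And>t. 0 \<le> V t" "\<And>t. V t \<le> 1 / 100" "V 0 \<noteq> 0"
    and d: "\<And>t. \<bar>d t\<bar> \<le> 1 / 100"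
    and V': "\<And>t. \<bar>V (Suc t) - V t * (1 + 4 * d t - 4 * V t)\<bar> \<le> V t * (\<bar>d t\<bar> + V t) / 10"
    and d': "\<And>t. 9 / 10 * (e * V t) \<le> d t - d (Suc t)"
  shows "V \<longlonglongrightarrow> 0" "\<exists>L<0. d \<longlonglongrightarrow> L"
proof -
  have dec: "decseq d"
  proof (rule decseq_SucI)
    fix t
    have "0 \<le> e * V t" using e V(1) by simp
    then show "d (Suc t) \<le> d t" using d'[of t] by argo
  qed
  have lower: "V t * (1 + 4 * d t - 4 * V t - (\<bar>d t\<bar> + V t) / 10) \<le> V (Suc t)" for t
    using abs_le_D2[OF V'[of t]] by (subst right_diff_distrib) simp
  have upper: "V (Suc t) \<le> V t * (1 + 4 * d t - 4 * V t + (\<bar>d t\<bar> + V t) / 10)" for t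
    using abs_le_D1[OF V'[of t]] by (subst distrib_left) simp
  have pos: "0 < V t" for t
  proof (induction t)
    case 0
    then show ?case using V(1)[of 0] V(3) by simp
  next
    case (Suc t)
    have "0 < V t * (1 + 4 * d t - 4 * V t - (\<bar>d t\<bar> + V t) / 10)"
      by (rule mult_pos_pos[OF Suc]) (use d[of t] V(2)[of t] in \<open>auto simp: abs_le_iff abs_if\<close>)
    then show ?case using lower[of t] by linarith
  qed
  \<comment> \<open>While \<open>d \<ge> 0\<close>, the logarithm of \<open>V\<close> drops by at most a constant multiple of the drop of \<open>d\<close>,
    so \<open>V\<close> stays away from \<open>0\<close> and forces \<open>d\<close> below any bound.\<close>
  have "\<exists>T. d T < 0"
  proof (rule ccontr)
    assume "\<nexists>T. d T < 0"
    then have nonneg: "0 \<le> d t" for t by (simp add: not_less)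
    \<comment> \<open>One step lowers \<open>ln V\<close> by at most 5V + 50V^2, hence by at most
      5.5V, while the drop of \<open>d\<close> times 10/e contributes at least 9V.\<close>
    have "ln (V t) - 10 / e * d t \<le> ln (V (Suc t)) - 10 / e * d (Suc t)" for t
    proof -
      have "V t * (1 - 5 * V t) \<le> V t * (1 + 4 * d t - 4 * V t - (\<bar>d t\<bar> + V t) / 10)"
        by (rule mult_left_mono) (use nonneg[of t] V(1)[of t] in argo, rule V(1))
      then have "V t * (1 - 5 * V t) \<le> V (Suc t)" using lower[of t] by linarith
      then have "ln (V t * (1 - 5 * V t)) \<le> ln (V (Suc t))"
        using pos[of t] pos[of "Suc t"] V(2)[of t] by (subst ln_le_cancel_iff) (auto intro!: mult_pos_pos)
      moreover have "ln (V t * (1 - 5 * V t)) = ln (V t) + ln (1 - 5 * V t)"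
        using pos[of t] V(2)[of t] by (intro ln_mult_pos) auto
      moreover have "- (5 * V t) - 2 * (5 * V t)\<^sup>2 \<le> ln (1 - 5 * V t)"
        by (rule ln_one_minus_pos_lower_bound) (use V(1,2)[of t] in auto)
      moreover have "(V t)\<^sup>2 \<le> V t * (1 / 100)"
        unfolding power2_eq_square by (rule mult_left_mono) (use V(1,2)[of t] in auto)
      moreover have "10 / e * (9 / 10 * (e * V t)) \<le> 10 / e * (d t - d (Suc t))"
        by (rule mult_left_mono[OF d']) (use e in auto)
      ultimately show ?thesis
        using e V(1)[of t] by (simp add: power_mult_distrib right_diff_distrib)
    qed
    then have "incseq (\<lambda>t. ln (V t) - 10 / e * d t)" by (rule incseq_SucI)
    then have "ln (V 0) - 10 / e * d 0 \<le> ln (V t) - 10 / e * d t" for t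
      by (auto simp: incseq_def)
    moreover have "0 \<le> 10 / e * d t" for t using nonneg e by simp
    ultimately have lnV: "ln (V 0) - 10 / e * d 0 \<le> ln (V t)" for t by (smt (verit))
    then have Vl: "exp (ln (V 0) - 10 / e * d 0) \<le> V t" for t
      using lnV[of t] ln_ge_iff[OF pos[of t]] by blast
    define v where "v = exp (ln (V 0) - 10 / e * d 0)"
    define c where "c = 9 / 10 * (e * v)"
    have c: "c > 0" using e by (simp add: c_def v_def)
    have step: "d (Suc t) \<le> d t - c" for t
    proof -
      have "e * v \<le> e * V t" using Vl[of t] e by (simp add: v_def)
      then show ?thesis using d'[of t] unfolding c_def by linarith
    qed
    have "d t \<le> d 0 - of_nat t * c" for t
    proof (induction t)
      case (Suc t)
      then show ?case using step[of t] by (simp add: algebra_simps)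
    qed simp
    moreover obtain n :: nat where "d 0 < of_nat n * c" using reals_Archimedean3[OF c] by blast
    ultimately show False using nonneg[of n] by (smt (verit))
  qed
  then obtain T where T: "d T < 0" by blast
  have "- (1 / 100) \<le> d t" for t using d[of t] by linarith
  then obtain L where L: "d \<longlonglongrightarrow> L" using decseq_convergent[OF dec] by blast
  have dT: "d (t + T) \<le> d T" for t using dec by (auto simp: decseq_def)
  have "L \<le> d T" by (rule decseq_ge[OF dec L])
  then show "\<exists>L<0. d \<longlonglongrightarrow> L" using T L by (intro exI[of _ L]) auto
  \<comment> \<open>For \<open>d \<le> d T < 0\<close> the growth factor of \<open>V\<close> is at
    most 1 + (4 - 1/10) d, as \<bar>d\<bar>/10 = -d/10.\<close>
  define q where "q = 1 + 39 / 10 * d T"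
  have q: "0 \<le> q" "q < 1" using T d[of T] by (auto simp: q_def abs_le_iff)
  have bound: "V (t + T) \<le> V T * q ^ t" for t
  proof (induction t)
    case (Suc t)
    have "V (Suc t + T) \<le> V (t + T) * q"
    proof -
      have "1 + 4 * d (t + T) - 4 * V (t + T) + (\<bar>d (t + T)\<bar> + V (t + T)) / 10 \<le> q"
        using dT[of t] T V(1)[of "t + T"] unfolding q_def by argo
      from mult_left_mono[OF this V(1)[of "t + T"]] upper[of "t + T"] show ?thesis by simp
    qed
    also have "\<dots> \<le> V T * q ^ t * q" by (rule mult_right_mono[OF Suc q(1)])
    finally show ?case by (simp add: mult_ac)
  qed simp
  have lim: "(\<lambda>t. V T * q ^ t) \<longlonglongrightarrow> 0"
    using q by (intro tendsto_mult_right_zero LIMSEQ_power_zero) auto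
  have "(\<lambda>t. V (t + T)) \<longlonglongrightarrow> 0"
    by (rule tendsto_sandwich[OF always_eventually always_eventually tendsto_const lim])
      (simp_all add: bound V(1))
  then show "V \<longlonglongrightarrow> 0" by (rule LIMSEQ_offset)
qed

section \<open>From the recursion to the trajectory\<close>

text \<open>Each coordinate is multiplied by a factor,
  \<open>x' = x (1 - \<eta> y\<^sup>2 f)\<close> and symmetrically for \<open>y\<close>. The
  resulting polynomial identities close the dynamics in \<open>f\<close>, \<open>r\<close> and
  \<open>s\<close>.\<close>

lemma gd_step_identities:
  fixes \<eta> x y x' y' :: real
  assumes x': "x' = x - \<eta> * x * y\<^sup>2 * (x\<^sup>2 * y\<^sup>2 - 1)" and y': "y' = y - \<eta> * x\<^sup>2 * y * (x\<^sup>2 * y\<^sup>2 - 1)"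
  defines "f \<equiv> x\<^sup>2 * y\<^sup>2 - 1"
  shows "x'\<^sup>2 * y'\<^sup>2 - 1 = (1 + f) * (1 - \<eta> * (x\<^sup>2 + y\<^sup>2) * f + \<eta>\<^sup>2 * (1 + f) * f\<^sup>2)\<^sup>2 - 1"
    and "\<eta> * (x'\<^sup>2 - y'\<^sup>2) = \<eta> * (x\<^sup>2 - y\<^sup>2) * (1 - \<eta>\<^sup>2 * (1 + f) * f\<^sup>2)"
    and "(\<eta> * (x\<^sup>2 + y\<^sup>2))\<^sup>2 = (\<eta> * (x\<^sup>2 - y\<^sup>2))\<^sup>2 + 4 * \<eta>\<^sup>2 * (1 + f)"
proof -
  have p: "x' = x * (1 - \<eta> * y\<^sup>2 * f)" "y' = y * (1 - \<eta> * x\<^sup>2 * f)"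
    unfolding x' y' f_def by algebra+
  have f1: "1 + f = x\<^sup>2 * y\<^sup>2" by (simp add: f_def)
  show "x'\<^sup>2 * y'\<^sup>2 - 1 = (1 + f) * (1 - \<eta> * (x\<^sup>2 + y\<^sup>2) * f + \<eta>\<^sup>2 * (1 + f) * f\<^sup>2)\<^sup>2 - 1"
    unfolding p f1 by algebra
  show "\<eta> * (x'\<^sup>2 - y'\<^sup>2) = \<eta> * (x\<^sup>2 - y\<^sup>2) * (1 - \<eta>\<^sup>2 * (1 + f) * f\<^sup>2)"
    unfolding p f1 by algebra
  show "(\<eta> * (x\<^sup>2 + y\<^sup>2))\<^sup>2 = (\<eta> * (x\<^sup>2 - y\<^sup>2))\<^sup>2 + 4 * \<eta>\<^sup>2 * (1 + f)"
    unfolding f1 by algebra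
qed

text \<open>Separates the dynamics from the parameter ranges: K and \<alpha> do not occur, only
  inequalities at time 0. \<open>L\<close> is the limit of \<open>d\<close>, so its bounds turn into
  bounds on the sharpness.\<close>

lemma trajectory_convergence:
  fixes \<eta> D :: real and x y :: "nat \<Rightarrow> real"
  defines "f \<equiv> \<lambda>t. (x t)\<^sup>2 * (y t)\<^sup>2 - 1"
    and "r \<equiv> \<lambda>t. \<eta> * ((x t)\<^sup>2 - (y t)\<^sup>2)"
  defines "d \<equiv> \<lambda>t. sqrt ((r t)\<^sup>2 + 4 * \<eta>\<^sup>2) - 1"
    and "V \<equiv> \<lambda>t. (f t + (1 / 2 + \<eta>\<^sup>2) * (f t)\<^sup>2)\<^sup>2"
    and "G \<equiv> \<lambda>w. 2 * w + D * w\<^sup>2"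
  assumes \<eta>: "0 < \<eta>" "\<eta>\<^sup>2 \<le> 1 / 10000" and D: "0 \<le> D" "\<eta>\<^sup>2 * D \<le> 1 / 10"
    and gd: "gd_trajectory \<eta> x y"
    and init: "0 < x 0" "0 < y 0" "0 < r 0" "\<bar>f 0\<bar> \<le> 1 / 20000" "f 0 \<noteq> 0"
      "0 \<le> d 0 + \<eta>\<^sup>2" "d 0 \<le> 1 / 10000" "V 0 \<le> G (d 0 + \<eta>\<^sup>2)" "G (d 0 + \<eta>\<^sup>2) \<le> (1 / 30000)\<^sup>2"
  shows "\<exists>a b L. x \<longlonglongrightarrow> a \<and> y \<longlonglongrightarrow> b \<and> a\<^sup>2 * b\<^sup>2 = 1 \<and> \<eta> * (a\<^sup>2 + b\<^sup>2) = 1 + L \<and> - \<eta>\<^sup>2 \<le> L \<and> L < 0"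
proof -
  define e where "e = \<eta>\<^sup>2"
  define s where "s t = \<eta> * ((x t)\<^sup>2 + (y t)\<^sup>2)" for t
  have e: "0 < e" "0 \<le> e" "e \<le> 1 / 10000" using \<eta> by (auto simp: e_def)
  have xs: "x (Suc t) = x t - \<eta> * x t * (y t)\<^sup>2 * f t" and ys: "y (Suc t) = y t - \<eta> * (x t)\<^sup>2 * y t * f t" for t
    using gd by (auto simp: gd_trajectory_def f_def)
  have fS: "f (Suc t) = (1 + f t) * (1 - s t * f t + e * (1 + f t) * (f t)\<^sup>2)\<^sup>2 - 1"
    and rS: "r (Suc t) = r t * (1 - e * (1 + f t) * (f t)\<^sup>2)"
    and s2: "(s t)\<^sup>2 = (r t)\<^sup>2 + 4 * e * (1 + f t)" for t
    using gd_step_identities[OF xs[of t, unfolded f_def] ys[of t, unfolded f_def]]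
    by (simp_all add: f_def r_def s_def e_def)
  have d1: "(r t)\<^sup>2 + 4 * e = (1 + d t)\<^sup>2" "0 \<le> 1 + d t" for t using e by (simp_all add: d_def e_def)
  have s2d: "(s t)\<^sup>2 = (1 + d t)\<^sup>2 + 4 * e * f t" for t
    using s2[of t] d1[of t] by (simp add: algebra_simps)
  have s0: "0 \<le> s t" for t using \<eta> by (simp add: s_def)
  have dS: "d (Suc t) = sqrt ((r (Suc t))\<^sup>2 + 4 * e) - 1" for t by (simp add: d_def e_def)
  have Vh: "V t = (f t + (1 / 2 + e) * (f t)\<^sup>2)\<^sup>2" for t by (simp add: V_def e_def)
  \<comment> \<open>The bound on \<open>f\<close> is half of what the one-step estimates need: a
    step at most doubles \<bar>f\<bar>, so they still apply to the next point, where the barrier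
    \<open>V \<le> (1/30000)\<^sup>2\<close> restores 1/20000.\<close>
  define good where "good t \<longleftrightarrow> \<bar>f t\<bar> \<le> 1 / 20000 \<and> 0 \<le> d t + e \<and> d t \<le> d 0 \<and> V t \<le> G (d t + e)" for t
  have G_mono: "G (d t + e) \<le> (1 / 30000)\<^sup>2" if "good t" for t
  proof -
    have "G (d t + e) \<le> G (d 0 + e)"
      unfolding G_def by (intro add_mono mult_left_mono power_mono) (use that D in \<open>auto simp: good_def\<close>)
    then show ?thesis using init(9) by (simp add: e_def)
  qed
  have bounds: "\<bar>f t\<bar> \<le> 1 / 10000" "\<bar>d t\<bar> \<le> 1 / 10000" if "good t" for t
    using that init(7) e by (auto simp: good_def abs_le_iff)
  have estimates: "\<bar>f (Suc t)\<bar> \<le> 2 * \<bar>f t\<bar>"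
      "\<bar>V (Suc t) - V t * (1 + 4 * d t - 4 * V t)\<bar> \<le> V t * (\<bar>d t\<bar> + V t) / 10"
      "9 / 10 * (e * V t) \<le> d t - d (Suc t)" "d t - 11 / 10 * (e * V t) \<le> d (Suc t)"
    if "good t" for t
    using step_square[OF bounds[OF that] e(2,3) s0 s2d fS refl refl]
      drift_step[OF bounds[OF that] e(2,3) d1(1) rS dS refl]
    unfolding Vh by blast+
  have V0: "0 \<le> V t" for t by (simp add: Vh)
  have good: "good t" for t
  proof (induction t)
    case 0
    then show ?case using init by (simp add: good_def e_def)
  next
    case (Suc t)
    have V': "V (Suc t) \<le> V t * (1 + 4 * d t - 4 * V t) + V t * (\<bar>d t\<bar> + V t) / 10"
      using abs_le_D1[OF estimates(2)[OF Suc]] by linarith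
    have G1: "2 * (d t + e) + D * (d t + e)\<^sup>2 \<le> 1 / 100"
      using G_mono[OF Suc] by (simp add: G_def power2_eq_square)
    have dt: "\<bar>d t\<bar> \<le> 1 / 100" using bounds(2)[OF Suc] by linarith
    have b: "0 \<le> d (Suc t) + e" "V (Suc t) \<le> G (d (Suc t) + e)"
      unfolding G_def
      by (rule barrier_step[OF e(1,3) D(1) _ V0 G1 _ dt _ V' estimates(4)[OF Suc]];
          use D(2) Suc in \<open>simp add: e_def good_def G_def\<close>)+
    have "0 \<le> e * V t" using e V0 by simp
    then have dd: "d (Suc t) \<le> d 0" using estimates(3)[OF Suc] Suc unfolding good_def by argo
    have f1: "\<bar>f (Suc t)\<bar> \<le> 1 / 10000" using estimates(1)[OF Suc] Suc unfolding good_def by argo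
    have "G (d (Suc t) + e) \<le> G (d 0 + e)"
      unfolding G_def by (intro add_mono mult_left_mono power_mono) (use b dd D in auto)
    then have "V (Suc t) \<le> (1 / 30000)\<^sup>2" using b(2) init(9) by (simp add: e_def)
    then have "\<bar>f (Suc t) + (1 / 2 + e) * (f (Suc t))\<^sup>2\<bar> \<le> 1 / 30000"
      unfolding Vh abs_le_square_iff[symmetric] by simp
    then have "\<bar>f (Suc t)\<bar> \<le> 1 / 20000"
      using corrected_square_bounds(1)[OF f1 e(2,3)] by linarith
    then show ?case using b dd by (simp add: good_def)
  qed
  note bounds = bounds[OF good] and estimates = estimates[OF good]
  have V1: "V t \<le> 1 / 100" for t
  proof -
    have "V t \<le> (1 / 30000)\<^sup>2" using G_mono[OF good] good[of t] unfolding good_def by (meson order_trans)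
    then show ?thesis by (simp add: power2_eq_square)
  qed
  have fV: "(f t)\<^sup>2 \<le> 100 / 98 * V t" for t
    using corrected_square_bounds(3)[OF bounds(1) e(2,3), of t] by (simp add: Vh)
  have "V 0 \<noteq> 0" using fV[of 0] init(5) by auto
  moreover have "\<bar>d t\<bar> \<le> 1 / 100" for t using bounds(2)[of t] by linarith
  ultimately obtain L where V_lim: "V \<longlonglongrightarrow> 0" and L: "L < 0" "d \<longlonglongrightarrow> L"
    using slow_drift_convergence[of e V d, OF e(1) V0 V1 _ _ estimates(2,3)] by metis
  have "- e \<le> d t" for t using good[of t] by (simp add: good_def)
  then have Le: "- e \<le> L" using L(2) by (intro LIMSEQ_le_const) auto
  have f_lim: "f \<longlonglongrightarrow> 0"
  proof -
    have "(\<lambda>t. 100 / 98 * V t) \<longlonglongrightarrow> 0" by (rule tendsto_mult_right_zero[OF V_lim])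
    then have "(\<lambda>t. (f t)\<^sup>2) \<longlonglongrightarrow> 0"
      by (rule tendsto_sandwich[OF always_eventually always_eventually tendsto_const, rotated 2])
        (simp_all only: fV zero_le_power2 simp_thms)
    then show ?thesis by simp
  qed

  have s_le: "s t \<le> 2" for t
  proof (rule power2_le_imp_le)
    have "(1 + d t)\<^sup>2 \<le> (11 / 10)\<^sup>2" by (rule power_mono) (use bounds(2)[of t] d1(2)[of t] in auto)
    moreover have "\<bar>e * f t\<bar> \<le> (1 / 10000) * 1" by (rule abs_mult_le) (use e bounds(1)[of t] in auto)
    ultimately show "(s t)\<^sup>2 \<le> 2\<^sup>2" unfolding s2d by (simp add: power2_eq_square abs_le_iff)
  qed simp
  have small: "\<eta> * u * f t < 1" if "0 \<le> \<eta> * u" "\<eta> * u \<le> s t" for u t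
  proof -
    have "\<bar>\<eta> * u * f t\<bar> \<le> 2 * (1 / 10000)"
      by (rule abs_mult_le) (use that s_le[of t] bounds(1)[of t] in auto)
    then show ?thesis by linarith
  qed
  \<comment> \<open>The factors 1 - \<eta> y^2 f and 1 - \<eta> x^2 f are positive as \<eta> x^2 and
    \<eta> y^2 are at most \<open>s \<le> 2\<close>. Positivity allows \<open>x\<close>,
    \<open>y\<close> and \<open>r\<close> to be recovered from their squares.\<close>
  have pos: "0 < x t \<and> 0 < y t \<and> 0 < r t" for t
  proof (induction t)
    case 0
    then show ?case using init by simp
  next
    case (Suc t)
    have "0 < x t * (1 - \<eta> * (y t)\<^sup>2 * f t)" "0 < y t * (1 - \<eta> * (x t)\<^sup>2 * f t)"
      using Suc \<eta> by (auto intro!: mult_pos_pos small simp: s_def)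
    moreover have "0 < r t * (1 - e * (1 + f t) * (f t)\<^sup>2)"
    proof -
      have "\<bar>e * (1 + f t) * (f t * f t)\<bar> \<le> 1 / 10000 * 2 * (1 / 10000 * (1 / 10000))"
        by (intro abs_mult_le bounds) (use e bounds(1)[of t] in auto)
      then show ?thesis using Suc by (auto intro!: mult_pos_pos simp: power2_eq_square)
    qed
    ultimately show ?case unfolding xs ys rS by (simp add: algebra_simps)
  qed

  \<comment> \<open>The limits of \<open>s\<close> and \<open>r\<close> determine those of x^2 and
    y^2. HOL's \<open>sqrt\<close> is continuous on the whole real line, so the signs of the
    arguments need no check.\<close>
  define R where "R = sqrt ((1 + L)\<^sup>2 - 4 * e)"
  have L1: "0 < 1 + L" using Le e by linarith
  have s_lim: "s \<longlonglongrightarrow> 1 + L"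
  proof -
    have "(\<lambda>t. sqrt ((1 + d t)\<^sup>2 + 4 * e * f t)) \<longlonglongrightarrow> sqrt ((1 + L)\<^sup>2 + 4 * e * 0)"
      by (intro tendsto_intros L f_lim)
    moreover have "s = (\<lambda>t. sqrt ((1 + d t)\<^sup>2 + 4 * e * f t))"
      unfolding s2d[symmetric] using s0 by simp
    ultimately show ?thesis using L1 by simp
  qed
  have r_lim: "r \<longlonglongrightarrow> R"
  proof -
    have "(\<lambda>t. sqrt ((1 + d t)\<^sup>2 - 4 * e)) \<longlonglongrightarrow> R"
      unfolding R_def by (intro tendsto_intros L)
    moreover have "r = (\<lambda>t. sqrt ((1 + d t)\<^sup>2 - 4 * e))"
      unfolding d1(1)[symmetric] using pos by (simp add: less_imp_le)
    ultimately show ?thesis by simp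
  qed
  define a where "a = sqrt ((1 + L + R) / (2 * \<eta>))"
  define b where "b = sqrt ((1 + L - R) / (2 * \<eta>))"
  have "(\<lambda>t. sqrt ((s t + r t) / (2 * \<eta>))) \<longlonglongrightarrow> a" "(\<lambda>t. sqrt ((s t - r t) / (2 * \<eta>))) \<longlonglongrightarrow> b"
    unfolding a_def b_def using \<eta> by (intro tendsto_intros s_lim r_lim; simp)+
  moreover have "(s t + r t) / (2 * \<eta>) = (x t)\<^sup>2" "(s t - r t) / (2 * \<eta>) = (y t)\<^sup>2" for t
    using \<eta> by (simp_all add: s_def r_def field_simps)
  ultimately have lim: "x \<longlonglongrightarrow> a" "y \<longlonglongrightarrow> b" using pos by (simp_all add: less_imp_le)
  have "f \<longlonglongrightarrow> a\<^sup>2 * b\<^sup>2 - 1" unfolding f_def by (intro tendsto_intros lim)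
  then have "a\<^sup>2 * b\<^sup>2 = 1" using LIMSEQ_unique[OF _ f_lim] by fastforce
  moreover have "s \<longlonglongrightarrow> \<eta> * (a\<^sup>2 + b\<^sup>2)" unfolding s_def by (intro tendsto_intros lim)
  then have "\<eta> * (a\<^sup>2 + b\<^sup>2) = 1 + L" using LIMSEQ_unique[OF _ s_lim] by blast
  ultimately show ?thesis using lim L(1) Le unfolding e_def by blast
qed

section \<open>Initial state and conclusion\<close>

text \<open>With \<open>k = 1/K\<close>, initially \<open>V \<le> 5k\<^sup>2\<close> and \<open>d + \<eta>\<^sup>2 \<ge> k\<^sup>2/41\<close>, which dictates the size of \<open>D\<close>.\<close>

lemma initial_state:
  fixes k \<alpha> \<eta> x y :: real
  defines "f \<equiv> x\<^sup>2 * y\<^sup>2 - 1" and "r \<equiv> \<eta> * (x\<^sup>2 - y\<^sup>2)" and "D \<equiv> 9000 / k\<^sup>2"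
  defines "d \<equiv> sqrt (r\<^sup>2 + 4 * \<eta>\<^sup>2) - 1" and "V \<equiv> (f + (1 / 2 + \<eta>\<^sup>2) * f\<^sup>2)\<^sup>2"
  assumes k: "0 < k" "k \<le> 1 / 10000000" and \<alpha>: "0 < \<alpha>" "\<alpha> < 1 / (2000 * sqrt 2) * k"
    and x: "1 / \<alpha> + 1 / 15 * k\<^sup>2 * (1 / \<alpha>) < x" "x < 1 / \<alpha> + 1 / 6 * k\<^sup>2 * (1 / \<alpha>)"
    and xy: "x * y \<noteq> 1" "\<bar>x * y - 1\<bar> < k"
    and \<eta>: "\<alpha>\<^sup>2 - 1 / 10 * k\<^sup>2 * \<alpha>\<^sup>2 < \<eta>" "\<eta> < \<alpha>\<^sup>2"
  shows "0 < \<eta>" "\<eta>\<^sup>2 \<le> 1 / 10000" "\<eta>\<^sup>2 * D \<le> 1 / 10" "0 < x" "0 < y" "0 < r"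
    "\<bar>f\<bar> \<le> 1 / 20000" "f \<noteq> 0" "0 \<le> d + \<eta>\<^sup>2" "d \<le> 1 / 10000"
    "V \<le> 2 * (d + \<eta>\<^sup>2) + D * (d + \<eta>\<^sup>2)\<^sup>2" "2 * (d + \<eta>\<^sup>2) + D * (d + \<eta>\<^sup>2)\<^sup>2 \<le> (1 / 30000)\<^sup>2"
proof -
  define c where "c = k\<^sup>2"
  have "k * k \<le> 1 / 10000000 * (1 / 10000000)" by (rule mult_mono) (use k in auto)
  then have c: "0 < c" "c \<le> 1 / 100000000000000" using k by (auto simp: c_def power2_eq_square)
  have c2: "0 \<le> c\<^sup>2" "c\<^sup>2 \<le> c / 100000000000000"
    using mult_left_mono[OF c(2), of c] c(1) by (auto simp: power2_eq_square)
  have \<alpha>2: "0 < \<alpha>\<^sup>2" "\<alpha>\<^sup>2 \<le> c / 8000000"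
  proof -
    have "\<alpha>\<^sup>2 \<le> (1 / (2000 * sqrt 2) * k)\<^sup>2" by (rule power_mono) (use \<alpha> in auto)
    then show "\<alpha>\<^sup>2 \<le> c / 8000000" by (simp add: c_def power_mult_distrib power_divide)
  qed (use \<alpha> in simp)
  \<comment> \<open>Rescaling removes \<alpha> from the leading quantity: \<eta> x^2 =
    \<open>\<nu> X\<^sup>2\<close>, with both \<open>\<nu>\<close> and \<open>X\<close> within order
    \<open>c\<close> of 1.\<close>
  define \<nu> where "\<nu> = \<eta> / \<alpha>\<^sup>2"
  define X where "X = \<alpha> * x"
  have \<nu>: "1 - c / 10 \<le> \<nu>" "\<nu> \<le> 1"
    using \<eta> \<alpha>2(1) by (simp_all add: \<nu>_def c_def field_simps)
  have X: "1 + c / 15 \<le> X" "X \<le> 1 + c / 6"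
    using x \<alpha> by (simp_all add: X_def c_def field_simps)
  have \<eta>\<nu>: "\<eta> = \<nu> * \<alpha>\<^sup>2" using \<alpha> by (simp add: \<nu>_def)
  show \<eta>0: "0 < \<eta>" unfolding \<eta>\<nu> using \<nu> c \<alpha>2 by (intro mult_pos_pos) auto
  define e where "e = \<eta>\<^sup>2"
  have "\<eta> * \<eta> \<le> c / 8000000 * (c / 8000000)" by (rule mult_mono) (use \<eta>0 \<eta>(2) \<alpha>2 in auto)
  then have e: "0 < e" "e \<le> c\<^sup>2 / 64000000000000" using \<eta>0 by (auto simp: e_def power2_eq_square)
  then have ec: "e \<le> c / 1000000" using c2 c by linarith
  show e1: "\<eta>\<^sup>2 \<le> 1 / 10000" using ec c by (simp add: e_def)
  have Dc: "D = 9000 / c" by (simp add: D_def c_def)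
  have "e * D \<le> c\<^sup>2 / 64000000000000 * (9000 / c)"
    unfolding Dc by (rule mult_right_mono[OF e(2)]) (use c in auto)
  also have "\<dots> \<le> 1 / 10" using c by (simp add: power2_eq_square)
  finally show "\<eta>\<^sup>2 * D \<le> 1 / 10" by (simp add: e_def)
  have "0 < 1 / \<alpha> + 1 / 15 * k\<^sup>2 * (1 / \<alpha>)" using \<alpha>(1) by (simp add: add_pos_nonneg)
  then show x0: "0 < x" using x(1) by linarith
  have p: "0 < x * y" "x * y \<le> 1 + k" "1 - k \<le> x * y" using xy(2) k by auto
  show y0: "0 < y" using p(1) x0 by (simp add: zero_less_mult_iff)
  have f: "f = (x * y - 1) * (x * y + 1)" unfolding f_def by algebra
  show "f \<noteq> 0" using xy(1) p(1) by (simp add: f)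
  have "\<bar>f\<bar> \<le> k * (21 / 10)" unfolding f by (rule abs_mult_le) (use xy(2) p k in auto)
  then have fk: "\<bar>f\<bar> \<le> 21 / 10 * k" by simp
  then show "\<bar>f\<bar> \<le> 1 / 20000" using k by linarith

  define u where "u = \<eta> * x\<^sup>2"
  define v where "v = \<eta> * y\<^sup>2"
  have u: "u = \<nu> * X\<^sup>2" by (simp add: u_def \<eta>\<nu> X_def power_mult_distrib)
  \<comment> \<open>The ranges of \<open>x\<close> and \<open>\<eta>\<close> fit together because
    2/15 - 1/10 = 1/30 is positive: \<open>u\<close> exceeds 1 by a fixed multiple of
    \<open>c\<close>, far more than the corrections of order \<open>e\<close>.\<close>
  have "(1 - c / 10) * (1 + 2 * (c / 15)) = 1 + c / 30 - c\<^sup>2 / 75"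
    by (simp add: power2_eq_square field_simps)
  then have "1 + c / 40 \<le> (1 - c / 10) * (1 + 2 * (c / 15))" using c c2 by linarith
  also have "\<dots> \<le> (1 - c / 10) * (1 + c / 15)\<^sup>2"
    by (rule mult_left_mono) (use c in \<open>auto simp: power2_eq_square algebra_simps\<close>)
  also have "\<dots> \<le> u"
    unfolding u by (intro mult_mono power_mono \<nu> X) (use \<nu> c in auto)
  finally have ul: "1 + c / 40 \<le> u" .
  have "u \<le> 1 * (1 + c / 6)\<^sup>2"
    unfolding u by (intro mult_mono power_mono \<nu> X) (use X c in auto)
  also have "\<dots> = 1 + c / 3 + c\<^sup>2 / 36" by (simp add: power2_eq_square field_simps)
  finally have uu: "u \<le> 1 + 2 * c / 5" using c c2 by linarith
  have uv: "u * v = e * (x * y)\<^sup>2" unfolding u_def v_def e_def by algebra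
  have v0: "0 \<le> v" using \<eta>0 by (simp add: v_def)
  have vu: "v \<le> 2 * e"
  proof -
    have "v \<le> u * v" using mult_right_mono[of 1 u v] ul c v0 by simp
    also have "\<dots> \<le> e * (11 / 10)\<^sup>2"
      unfolding uv by (intro mult_left_mono power_mono) (use p k e in auto)
    finally show ?thesis using e by (simp add: power2_eq_square)
  qed
  have r: "r = u - v" by (simp add: r_def u_def v_def algebra_simps)
  have rl: "1 + c / 40 - 2 * e \<le> r" and ru: "r \<le> u" using ul vu v0 by (auto simp: r)
  show r0: "0 < r" using rl ec c by linarith
  have "r \<le> sqrt (r\<^sup>2 + 4 * e)" by (rule real_le_rsqrt) (use e in simp)
  then have dl: "c / 41 \<le> d + e" using rl ec c by (simp add: d_def e_def)
  have "sqrt (r\<^sup>2 + 4 * e) \<le> u + 2 * e"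
  proof (rule real_le_lsqrt)
    have "r\<^sup>2 \<le> u\<^sup>2" by (rule power_mono) (use ru r0 in auto)
    moreover have "1 * e \<le> u * e" by (rule mult_right_mono) (use ul c e in auto)
    moreover have "(u + 2 * e)\<^sup>2 = u\<^sup>2 + 4 * (u * e) + 4 * (e * e)" by algebra
    moreover have "0 \<le> e * e" by simp
    ultimately show "r\<^sup>2 + 4 * e \<le> (u + 2 * e)\<^sup>2" by linarith
  qed (use ul c e in auto)
  then have du: "d + e \<le> c / 2" using uu ec c by (simp add: d_def e_def)
  show "0 \<le> d + \<eta>\<^sup>2" using dl c by (simp add: e_def)
  show "d \<le> 1 / 10000" using du e c by linarith
  have D0: "0 \<le> D" using c by (simp add: Dc)
  have "V \<le> 5 * c"
  proof -
    have f2: "f\<^sup>2 \<le> (21 / 10 * k)\<^sup>2" using power_mono[OF fk, of 2] by simp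
    have "V \<le> 103 / 100 * f\<^sup>2"
      unfolding V_def by (rule corrected_square_bounds) (use fk k e1 in auto)
    then show ?thesis using f2 c by (simp add: power_mult_distrib c_def power2_eq_square)
  qed
  \<comment> \<open>The constant 9000 exceeds 5 * 41^2, so the quadratic term of the barrier alone
    covers the initial \<open>V\<close>.\<close>
  also have "5 * c \<le> D * (c / 41)\<^sup>2" using c by (simp add: Dc power2_eq_square)
  also have "\<dots> \<le> 2 * (d + e) + D * (d + e)\<^sup>2"
    by (intro add_increasing mult_left_mono power_mono dl D0) (use c dl in auto)
  finally show "V \<le> 2 * (d + \<eta>\<^sup>2) + D * (d + \<eta>\<^sup>2)\<^sup>2" by (simp add: e_def)
  have "2 * (d + e) + D * (d + e)\<^sup>2 \<le> 2 * (c / 2) + D * (c / 2)\<^sup>2"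
    by (intro add_mono mult_left_mono power_mono du D0) (use dl c in auto)
  also have "\<dots> \<le> 2251 * c" using c by (simp add: Dc power2_eq_square)
  also have "\<dots> \<le> (1 / 30000)\<^sup>2" using c by (simp add: power2_eq_square)
  finally show "2 * (d + \<eta>\<^sup>2) + D * (d + \<eta>\<^sup>2)\<^sup>2 \<le> (1 / 30000)\<^sup>2" by (simp add: e_def)
qed

theorem corollary3p2:
  shows "\<exists>K\<^sub>0::real. \<forall>K \<ge> K\<^sub>0. \<forall>\<alpha>::real. 0 < \<alpha> \<longrightarrow> \<alpha> < 1 / (2000 * sqrt 2) * (1 / K) \<longrightarrow>
    (\<forall>(\<eta>::real) (x :: nat \<Rightarrow> real) (y :: nat \<Rightarrow> real).
       x 0 \<in> {1 / \<alpha> + 1 / 15 * (1 / K\<^sup>2) * (1 / \<alpha>) <..< 1 / \<alpha> + 1 / 6 * (1 / K\<^sup>2) * (1 / \<alpha>)} \<longrightarrow>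
       \<bar>x 0 * y 0 - 1\<bar> \<in> {0 <..< 1 / K} \<longrightarrow>
       \<eta> \<in> {\<alpha>\<^sup>2 - 1 / 10 * (1 / K\<^sup>2) * \<alpha>\<^sup>2 <..< \<alpha>\<^sup>2} \<longrightarrow>
       gd_trajectory \<eta> x y \<longrightarrow>
       (\<exists>a b. x \<longlonglongrightarrow> a \<and> y \<longlonglongrightarrow> b \<and>
          global_minimum a b \<and>
          sharpness a b \<in> {2 / \<eta> - 20 / 3 * \<eta> <..< 2 / \<eta>}))"
proof (rule exI[of _ 10000000], intro allI impI)
  fix K \<alpha> \<eta> :: real and x y :: "nat \<Rightarrow> real"
  assume K: "10000000 \<le> K" and \<alpha>: "0 < \<alpha>" "\<alpha> < 1 / (2000 * sqrt 2) * (1 / K)"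
    and x: "x 0 \<in> {1 / \<alpha> + 1 / 15 * (1 / K\<^sup>2) * (1 / \<alpha>) <..< 1 / \<alpha> + 1 / 6 * (1 / K\<^sup>2) * (1 / \<alpha>)}"
    and xy: "\<bar>x 0 * y 0 - 1\<bar> \<in> {0 <..< 1 / K}"
    and \<eta>: "\<eta> \<in> {\<alpha>\<^sup>2 - 1 / 10 * (1 / K\<^sup>2) * \<alpha>\<^sup>2 <..< \<alpha>\<^sup>2}"
    and gd: "gd_trajectory \<eta> x y"
  have k: "0 < 1 / K" "1 / K \<le> 1 / 10000000" using K by (auto intro: divide_left_mono)
  have sq: "(1 / K)\<^sup>2 = 1 / K\<^sup>2" by (simp add: power_divide)
  note init = initial_state[OF k \<alpha>, unfolded sq, of "x 0" "y 0" \<eta>]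
  have *: "1 / \<alpha> + 1 / 15 * (1 / K\<^sup>2) * (1 / \<alpha>) < x 0" "x 0 < 1 / \<alpha> + 1 / 6 * (1 / K\<^sup>2) * (1 / \<alpha>)"
    "x 0 * y 0 \<noteq> 1" "\<bar>x 0 * y 0 - 1\<bar> < 1 / K"
    "\<alpha>\<^sup>2 - 1 / 10 * (1 / K\<^sup>2) * \<alpha>\<^sup>2 < \<eta>" "\<eta> < \<alpha>\<^sup>2"
    using x xy \<eta> by auto
  note init = init[OF *]
  have "0 \<le> 9000 / (1 / K\<^sup>2)" by simp
  from trajectory_convergence[OF init(1,2) this init(3) gd init(4-12)]
  obtain a b L where lim: "x \<longlonglongrightarrow> a" "y \<longlonglongrightarrow> b" and ab: "a\<^sup>2 * b\<^sup>2 = 1"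
    and L: "\<eta> * (a\<^sup>2 + b\<^sup>2) = 1 + L" "- \<eta>\<^sup>2 \<le> L" "L < 0" by blast
  have \<eta>0: "0 < \<eta>" by (rule init(1))
  have "sharpness a b = 2 * (1 + L) / \<eta>"
    using sharpness_at_minimum[OF ab] L(1) \<eta>0 by (simp add: field_simps)
  moreover have "2 * (1 + L) / \<eta> < 2 / \<eta>"
    by (rule divide_strict_right_mono[OF _ \<eta>0]) (use L(3) in simp)
  \<comment> \<open>\<open>L \<ge> -\<eta>\<^sup>2\<close> even gives the lower bound 2/\<eta> -
    2\<eta>.\<close>
  moreover have "2 / \<eta> - 20 / 3 * \<eta> < 2 * (1 + L) / \<eta>"
  proof -
    have "0 < \<eta>\<^sup>2" using \<eta>0 by simp
    then have "2 - 20 / 3 * \<eta>\<^sup>2 < 2 * (1 + L)" using L(2) by argo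
    then have "(2 - 20 / 3 * \<eta>\<^sup>2) / \<eta> < 2 * (1 + L) / \<eta>" using \<eta>0 by (rule divide_strict_right_mono)
    moreover have "(2 - 20 / 3 * \<eta>\<^sup>2) / \<eta> = 2 / \<eta> - 20 / 3 * \<eta>"
      using \<eta>0 by (simp add: diff_divide_distrib power2_eq_square)
    ultimately show ?thesis by simp
  qed
  ultimately show "\<exists>a b. x \<longlonglongrightarrow> a \<and> y \<longlonglongrightarrow> b \<and> global_minimum a b \<and>
      sharpness a b \<in> {2 / \<eta> - 20 / 3 * \<eta> <..< 2 / \<eta>}"
    using lim ab by (intro exI[of _ a] exI[of _ b]) (auto simp: global_minimum_def)
qed

end
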